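(* Let $\prec$ be any antisymmetric relation on terms. If $\Gamma\Rightarrow\Delta$ is derivable in $\mathcal{R}_{12}^r=\{\overline{\mathrm{Ref}},\mathrm{Rep}_1^{r},\mathrm{Rep}_2^{r}\}$, then $\Gamma\Rightarrow\Delta$ has a semishortening derivation in $\mathcal{R}_{12}^{rl+}=\{\overline{\mathrm{Ref}},\mathrm{Rep}_1^{l+},\mathrm{Rep}_2^{l+},\mathrm{Rep}_1^{r},\mathrm{Rep}_2^{r}\}$.
   Context: Formulas are those of a first-order language with equality (constants and function symbols allowed), with bound variables syntactically distinct from free ones; equalities $t=t'$ are atomic; $\bot$ is not counted as atomic. A sequent $\Gamma\Rightarrow\Delta$ consists of finite multisets $\Gamma,\Delta$ of formulas; comma is multiset union. $P[x/r]$ is the result of replacing all occurrences of $x$ in the atomic formula $P$ by the term $r$. A set $\mathcal R$ of rules is identified with the calculus whose initial sequents are $P,\Gamma\Rightarrow\Delta,P$ ($P$ atomic) together with $\bot,\Gamma\Rightarrow\Delta$ in the intuitionistic and classical case, respectively $\bot,\Gamma\Rightarrow\Delta,\bot$ in the minimal case, and whose rules are those of $\mathcal R$ (no logical rules); statements about $\mathcal R$ are meant for each of these cases. Equality rules ($P$ atomic, possibly an equality); the first antecedent formula displayed in each rule below is its operating equality. $\overline{\mathrm{Ref}}$: axioms $\Gamma\Rightarrow\Delta,t=t$. $\mathrm{Rep}_1^{r}$: from $r=s,\Gamma\Rightarrow\Delta,P[x/r]$ infer $r=s,\Gamma\Rightarrow\Delta,P[x/s]$. $\mathrm{Rep}_2^{r}$: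 from $s=r,\Gamma\Rightarrow\Delta,P[x/r]$ infer $s=r,\Gamma\Rightarrow\Delta,P[x/s]$. $\mathrm{Rep}_1^{l}$: from $r=s,P[x/r],\Gamma\Rightarrow\Delta$ infer $r=s,P[x/s],\Gamma\Rightarrow\Delta$. $\mathrm{Rep}_2^{l}$: from $s=r,P[x/r],\Gamma\Rightarrow\Delta$ infer $s=r,P[x/s],\Gamma\Rightarrow\Delta$. $\mathrm{Rep}_1^{l+}$: the rule $\mathrm{Rep}_1^{l}$ with its instances in which $P$ is an equality $E$ replaced by: from $r=s,E[x/s],E[x/r],\Gamma\Rightarrow\Delta$ infer $r=s,E[x/s],\Gamma\Rightarrow\Delta$. $\mathrm{Rep}_2^{l+}$: the rule $\mathrm{Rep}_2^{l}$ with its instances in which $P$ is an equality $E$ replaced by: from $s=r,E[x/s],E[x/r],\Gamma\Rightarrow\Delta$ infer $s=r,E[x/s],\Gamma\Rightarrow\Delta$. With $r,s$ as in the schemata above, an application of a rule with operating equality $r=s$ (index $1$) or $s=r$ (index $2$) is nonlengthening if $s\not\prec r$ and shortening if $r\prec s$. A derivation is semishortening if all its equality inferences with index $2$ are nonlengthening and all those with index $1$ are shortening. *)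

theory Defs
  imports "HOL-Library.Multiset"
begin

section \<open>Terms, formulas and sequents\<close>

text \<open>A language is an arbitrary set of function symbols (constants have arity 0) and an
  arbitrary set of predicate symbols, each symbol paired with its arity.\<close>

record ('f, 'p) language =
  funs :: "('f \<times> nat) set"
  preds :: "('p \<times> nat) set"

text \<open>Free and bound variables are syntactically distinct. Raw terms may contain bound
  variables, since they occur below quantifiers; a term proper contains none (\<open>is_term\<close>).\<close>

datatype 'f tm = Free nat | Bound nat | Fun 'f "'f tm list"

text \<open>Falsity is not an atom, whereas equalities are.\<close>

datatype ('f, 'p) atom = Eq "'f tm" "'f tm" | Pred 'p "'f tm list"

datatype ('f, 'p) fm =
    Atom "('f, 'p) atom"
  | Bot
  | Con "('f, 'p) fm" "('f, 'p) fm"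
  | Dis "('f, 'p) fm" "('f, 'p) fm"
  | Imp "('f, 'p) fm" "('f, 'p) fm"
  | All nat "('f, 'p) fm"
  | Ex nat "('f, 'p) fm"

text \<open>The argument \<open>B\<close> below is the set of bound variables whose scope we are in.\<close>

fun wf_tm :: "('f, 'p) language \<Rightarrow> nat set \<Rightarrow> 'f tm \<Rightarrow> bool" where
  "wf_tm L B (Free x) \<longleftrightarrow> True"
| "wf_tm L B (Bound x) \<longleftrightarrow> x \<in> B"
| "wf_tm L B (Fun f ts) \<longleftrightarrow> (f, length ts) \<in> funs L \<and> (\<forall>t \<in> set ts. wf_tm L B t)"

fun wf_atom :: "('f, 'p) language \<Rightarrow> nat set \<Rightarrow> ('f, 'p) atom \<Rightarrow> bool" where
  "wf_atom L B (Eq s t) \<longleftrightarrow> wf_tm L B s \<and> wf_tm L B t"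
| "wf_atom L B (Pred p ts) \<longleftrightarrow> (p, length ts) \<in> preds L \<and> (\<forall>t \<in> set ts. wf_tm L B t)"

fun wf_fm :: "('f, 'p) language \<Rightarrow> nat set \<Rightarrow> ('f, 'p) fm \<Rightarrow> bool" where
  "wf_fm L B (Atom P) \<longleftrightarrow> wf_atom L B P"
| "wf_fm L B Bot \<longleftrightarrow> True"
| "wf_fm L B (Con F G) \<longleftrightarrow> wf_fm L B F \<and> wf_fm L B G"
| "wf_fm L B (Dis F G) \<longleftrightarrow> wf_fm L B F \<and> wf_fm L B G"
| "wf_fm L B (Imp F G) \<longleftrightarrow> wf_fm L B F \<and> wf_fm L B G"
| "wf_fm L B (All x F) \<longleftrightarrow> wf_fm L (insert x B) F"
| "wf_fm L B (Ex x F) \<longleftrightarrow> wf_fm L (insert x B) F"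

definition is_term :: "('f, 'p) language \<Rightarrow> 'f tm \<Rightarrow> bool" where
  "is_term L t \<longleftrightarrow> wf_tm L {} t"

definition is_formula :: "('f, 'p) language \<Rightarrow> ('f, 'p) fm \<Rightarrow> bool" where
  "is_formula L F \<longleftrightarrow> wf_fm L {} F"

datatype ('f, 'p) sequent =
  Sequent "('f, 'p) fm multiset" "('f, 'p) fm multiset"  (infix "\<turnstile>" 55)

fun is_sequent :: "('f, 'p) language \<Rightarrow> ('f, 'p) sequent \<Rightarrow> bool" where
  "is_sequent L (\<Gamma> \<turnstile> \<Delta>) \<longleftrightarrow> (\<forall>F \<in># \<Gamma> + \<Delta>. is_formula L F)"

fun subst_tm :: "'f tm \<Rightarrow> nat \<Rightarrow> 'f tm \<Rightarrow> 'f tm" where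
  "subst_tm (Free y) x r = (if y = x then r else Free y)"
| "subst_tm (Bound y) x r = Bound y"
| "subst_tm (Fun f ts) x r = Fun f (map (\<lambda>t. subst_tm t x r) ts)"

fun subst :: "('f, 'p) atom \<Rightarrow> nat \<Rightarrow> 'f tm \<Rightarrow> ('f, 'p) atom"  ("_[_'/_]" [1000, 0, 0] 1000) where
  "(Eq s t)[x/r] = Eq (subst_tm s x r) (subst_tm t x r)"
| "(Pred p ts)[x/r] = Pred p (map (\<lambda>t. subst_tm t x r) ts)"

fun is_Eq :: "('f, 'p) atom \<Rightarrow> bool" where
  "is_Eq (Eq s t) \<longleftrightarrow> True"
| "is_Eq (Pred p ts) \<longleftrightarrow> False"


section \<open>Rules and derivations\<close>

datatype logic = Minimal | Intuitionistic | Classical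

inductive initial :: "logic \<Rightarrow> ('f, 'p) sequent \<Rightarrow> bool" for lg where
  "initial lg (add_mset (Atom P) \<Gamma> \<turnstile> add_mset (Atom P) \<Delta>)"
| "lg \<in> {Intuitionistic, Classical} \<Longrightarrow> initial lg (add_mset Bot \<Gamma> \<turnstile> \<Delta>)"
| "lg = Minimal \<Longrightarrow> initial lg (add_mset Bot \<Gamma> \<turnstile> add_mset Bot \<Delta>)"

inductive ref_axiom :: "('f, 'p) sequent \<Rightarrow> bool" where
  "ref_axiom (\<Gamma> \<turnstile> add_mset (Atom (Eq t t)) \<Delta>)"

datatype index = One | Two

fun operating :: "index \<Rightarrow> 'f tm \<Rightarrow> 'f tm \<Rightarrow> ('f, 'p) fm" where
  "operating One r s = Atom (Eq r s)"
| "operating Two r s = Atom (Eq s r)"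

datatype rule = Ref | RepR index | RepLplus index

text \<open>\<open>inference \<rho> r s S S'\<close>: the rule \<open>\<rho>\<close>, with \<open>r\<close> and \<open>s\<close> as in its schema, leads from
  the premise \<open>S\<close> to the conclusion \<open>S'\<close>.\<close>

inductive inference ::
  "rule \<Rightarrow> 'f tm \<Rightarrow> 'f tm \<Rightarrow> ('f, 'p) sequent \<Rightarrow> ('f, 'p) sequent \<Rightarrow> bool" where
  right:
    "inference (RepR i) r s
       (add_mset (operating i r s) \<Gamma> \<turnstile> add_mset (Atom (P[x/r])) \<Delta>)
       (add_mset (operating i r s) \<Gamma> \<turnstile> add_mset (Atom (P[x/s])) \<Delta>)"
| left_pred:
    "\<not> is_Eq P \<Longrightarrow> inference (RepLplus i) r s
       (add_mset (operating i r s) (add_mset (Atom (P[x/r])) \<Gamma>) \<turnstile> \<Delta>)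
       (add_mset (operating i r s) (add_mset (Atom (P[x/s])) \<Gamma>) \<turnstile> \<Delta>)"
| left_eq:
    "is_Eq E \<Longrightarrow> inference (RepLplus i) r s
       (add_mset (operating i r s) (add_mset (Atom (E[x/s])) (add_mset (Atom (E[x/r])) \<Gamma>)) \<turnstile> \<Delta>)
       (add_mset (operating i r s) (add_mset (Atom (E[x/s])) \<Gamma>) \<turnstile> \<Delta>)"

text \<open>The equality inferences of a derivation tree are labelled with the rule applied and with
  the terms \<open>r\<close> and \<open>s\<close> of its schema.\<close>

datatype ('f, 'p) derivation =
    Axiom "('f, 'p) sequent"
  | Infer rule "'f tm" "'f tm" "('f, 'p) derivation" "('f, 'p) sequent"

fun endsequent :: "('f, 'p) derivation \<Rightarrow> ('f, 'p) sequent" where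
  "endsequent (Axiom S) = S"
| "endsequent (Infer \<rho> r s D S) = S"

text \<open>All sequents of a derivation consist of formulas of \<open>L\<close>. This forces the \<open>r\<close>, \<open>s\<close> and
  \<open>P\<close> of every inference to belong to \<open>L\<close> as well: \<open>r\<close> and \<open>s\<close> are the sides of the operating
  equality, and \<open>P[x/s]\<close> is a formula of \<open>L\<close> only if \<open>P\<close> is.\<close>

fun is_derivation ::
  "('f, 'p) language \<Rightarrow> logic \<Rightarrow> rule set \<Rightarrow> ('f, 'p) derivation \<Rightarrow> bool" where
  "is_derivation L lg R (Axiom S) \<longleftrightarrow>
     is_sequent L S \<and> (initial lg S \<or> Ref \<in> R \<and> ref_axiom S)"
| "is_derivation L lg R (Infer \<rho> r s D S) \<longleftrightarrow>
     is_sequent L S \<and> \<rho> \<in> R \<and> inference \<rho> r s (endsequent D) S \<and> is_derivation L lg R D"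

definition derivable ::
  "('f, 'p) language \<Rightarrow> logic \<Rightarrow> rule set \<Rightarrow> ('f, 'p) sequent \<Rightarrow> bool" where
  "derivable L lg R S \<longleftrightarrow> (\<exists>D. is_derivation L lg R D \<and> endsequent D = S)"

definition R12r :: "rule set" where
  "R12r = {Ref, RepR One, RepR Two}"

definition R12rlplus :: "rule set" where
  "R12rlplus = {Ref, RepLplus One, RepLplus Two, RepR One, RepR Two}"


section \<open>Nonlengthening, shortening and semishortening\<close>

definition nonlengthening :: "('f tm \<Rightarrow> 'f tm \<Rightarrow> bool) \<Rightarrow> 'f tm \<Rightarrow> 'f tm \<Rightarrow> bool" where
  "nonlengthening prec r s \<longleftrightarrow> \<not> prec s r"

definition shortening :: "('f tm \<Rightarrow> 'f tm \<Rightarrow> bool) \<Rightarrow> 'f tm \<Rightarrow> 'f tm \<Rightarrow> bool" where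
  "shortening prec r s \<longleftrightarrow> prec r s"

fun has_index :: "rule \<Rightarrow> index \<Rightarrow> bool" where
  "has_index Ref i \<longleftrightarrow> False"
| "has_index (RepR j) i \<longleftrightarrow> j = i"
| "has_index (RepLplus j) i \<longleftrightarrow> j = i"

fun semishortening :: "('f tm \<Rightarrow> 'f tm \<Rightarrow> bool) \<Rightarrow> ('f, 'p) derivation \<Rightarrow> bool" where
  "semishortening prec (Axiom S) \<longleftrightarrow> True"
| "semishortening prec (Infer \<rho> r s D S) \<longleftrightarrow>
     (has_index \<rho> Two \<longrightarrow> nonlengthening prec r s) \<and>
     (has_index \<rho> One \<longrightarrow> shortening prec r s) \<and>
     semishortening prec D"

end

theory Submission
  imports Defs
begin

text \<open>Read from the conclusion to the premise, an equality inference rewrites an atom with an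
  equality of the antecedent. A semishortening derivation may use each equality \<open>a = b\<close> in
  exactly one direction: from \<open>a\<close> to \<open>b\<close> (index 2) if \<open>a \<prec> b\<close> fails, and from \<open>b\<close> to \<open>a\<close>
  (index 1) if it holds. So \<open>\<prec>\<close> only serves to orient the equalities, and the task is to show
  that replacement against the orientation is admissible (\<open>reducible_against\<close>).

  This is an argument by critical pairs. Let \<open>E\<close> be oriented from \<open>r\<close> to \<open>s\<close>, and let a
  derivation of \<open>\<Gamma> \<Rightarrow> \<Delta>, P\<close> be given, where \<open>P'\<close> arises from \<open>P\<close> by replacing one occurrence of
  \<open>r\<close> by \<open>s\<close>. The interesting case is that the last inference rewrites \<open>P\<close> itself, by an
  equality oriented from \<open>u\<close> to \<open>v\<close>, into some \<open>Q\<close>. If the replaced occurrences of \<open>r\<close> and \<open>u\<close>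
  are disjoint, the two replacements commute. If \<open>r\<close> lies in \<open>u\<close>, replacing it there turns
  \<open>u\<close> into some \<open>u'\<close>, and \<open>P'\<close> and \<open>Q\<close> differ only by \<open>u'\<close> against \<open>v\<close>. A left rule, which
  keeps the equality it rewrites, adds the equality of \<open>u'\<close> and \<open>v\<close> to the antecedent. Nothing
  is known about the orientation of this new equality, but both are fine. If it goes from \<open>u'\<close>
  to \<open>v\<close>, then one more right inference rewrites \<open>P'\<close> to \<open>Q\<close>. Otherwise \<open>P'\<close> comes from \<open>Q\<close>
  by a replacement against the orientation, and the induction hypothesis applies, because \<open>Q\<close>
  has the shorter derivation. The case that \<open>u\<close> lies in \<open>r\<close> is symmetric. Since the induction
  is on derivations and not on terms, \<open>\<prec>\<close> may be ill-founded.

  The overlap analysis (\<open>rewr_atom_overlap\<close>) is this simple only when a step replaces a single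
  occurrence. Therefore the proof passes through an auxiliary calculus, \<open>reducible\<close>, of oriented
  single replacements. Replacement by substitution is a sequence of single replacements
  (\<open>subst_rewr_atom_star\<close>), which takes every derivation in \<open>R12r\<close> into the auxiliary calculus;
  conversely, a single replacement is an instance of substitution for a fresh variable
  (\<open>rewr_atom_context\<close>), which leads from there to semishortening derivations.\<close>

section \<open>Replacement at a single position\<close>

inductive rewr :: "'f tm \<Rightarrow> 'f tm \<Rightarrow> 'f tm \<Rightarrow> 'f tm \<Rightarrow> bool"
  and rewrs :: "'f tm \<Rightarrow> 'f tm \<Rightarrow> 'f tm list \<Rightarrow> 'f tm list \<Rightarrow> bool" for r s where
  root: "rewr r s r s"
| arg: "rewrs r s ts us \<Longrightarrow> rewr r s (Fun f ts) (Fun f us)"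
| head: "rewr r s t u \<Longrightarrow> rewrs r s (t # ts) (u # ts)"
| tail: "rewrs r s ts us \<Longrightarrow> rewrs r s (t # ts) (t # us)"

inductive rewr_atom :: "'f tm \<Rightarrow> 'f tm \<Rightarrow> ('f, 'p) atom \<Rightarrow> ('f, 'p) atom \<Rightarrow> bool" for r s where
  Eq: "rewrs r s [a, b] [c, d] \<Longrightarrow> rewr_atom r s (Eq a b) (Eq c d)"
| Pred: "rewrs r s ts us \<Longrightarrow> rewr_atom r s (Pred p ts) (Pred p us)"

inductive_cases rewrs_NilE: "rewrs r s [] us"
inductive_cases rewrs_ConsE: "rewrs r s (t # ts) us"
inductive_cases rewr_FunE: "rewr r s (Fun f ts) u"
inductive_cases rewr_atom_EqE: "rewr_atom r s (Eq a b) B"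
inductive_cases rewr_atom_PredE: "rewr_atom r s (Pred p ts) B"

lemma rewr_sym:
  "rewr r s t u \<Longrightarrow> rewr s r u t"
  "rewrs r s ts us \<Longrightarrow> rewrs s r us ts"
  by (induction rule: rewr_rewrs.inducts) (auto intro: rewr_rewrs.intros)

lemma rewr_atom_sym: "rewr_atom r s A B \<Longrightarrow> rewr_atom s r B A"
  by (auto elim!: rewr_atom.cases intro!: rewr_atom.intros rewr_sym)

lemma rewr_trivial:
  "rewr r s t u \<Longrightarrow> r = s \<Longrightarrow> t = u"
  "rewrs r s ts us \<Longrightarrow> r = s \<Longrightarrow> ts = us"
  by (induction rule: rewr_rewrs.inducts) auto

lemma rewr_atom_trivial: "rewr_atom r r A B \<Longrightarrow> A = B"
  by (auto elim!: rewr_atom.cases dest!: rewr_trivial(2))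

lemma rewr_size:
  "rewr r s t u \<Longrightarrow> size r \<le> size t"
  "rewrs r s ts us \<Longrightarrow> size r < size_list size ts"
  by (induction rule: rewr_rewrs.inducts) auto

text \<open>A term does not occur properly in itself.\<close>

lemma rewr_self:
  assumes "rewr r s r u"
  shows "u = s"
  using assms by cases (auto dest: rewr_size)

lemma rewr_atom_Eq_iff:
  "rewr_atom r s (Eq a b) B \<longleftrightarrow>
     (\<exists>c. rewr r s a c \<and> B = Eq c b) \<or> (\<exists>d. rewr r s b d \<and> B = Eq a d)"
  by (auto elim!: rewr_atom_EqE rewrs_ConsE rewrs_NilE intro!: rewr_atom.Eq
      intro: rewr_rewrs.intros)

text \<open>Two positions in a term are disjoint or one lies above the other. In the second case
  the two results of replacement differ at the upper position only, where one of them has the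
  right side of the upper rule and the other the left side with the lower replacement carried
  out in it. Equal positions fall under either nested alternative.\<close>

lemma rewr_overlap:
  "rewr r s t t' \<Longrightarrow> rewr u v t w \<Longrightarrow>
     (\<exists>z. rewr u v t' z \<and> rewr r s w z) \<or>
     (\<exists>u'. rewr r s u u' \<and> rewr u' v t' w) \<or>
     (\<exists>r'. rewr u v r r' \<and> rewr r' s w t')"
  "rewrs r s ts ts' \<Longrightarrow> rewrs u v ts ws \<Longrightarrow>
     (\<exists>zs. rewrs u v ts' zs \<and> rewrs r s ws zs) \<or>
     (\<exists>u'. rewr r s u u' \<and> rewrs u' v ts' ws) \<or>
     (\<exists>r'. rewr u v r r' \<and> rewrs r' s ws ts')"
proof (induction arbitrary: w and ws rule: rewr_rewrs.inducts)
  case root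
  then show ?case by (blast intro: rewr_rewrs.intros)
next
  case (arg ts us f)
  from arg.prems show ?case
  proof cases
    case root
    then show ?thesis using arg(1) by (metis rewr_rewrs.root rewr_rewrs.arg)
  next
    case (arg ws)
    then show ?thesis using "arg.IH" by (blast intro: rewr_rewrs.intros)
  qed
next
  case (head t t' ts)
  from head.prems show ?case
    by (cases rule: rewrs.cases) (use head in \<open>blast intro: rewr_rewrs.intros\<close>)+
next
  case (tail ts ts' t)
  from tail.prems show ?case
    by (cases rule: rewrs.cases) (use tail in \<open>blast intro: rewr_rewrs.intros\<close>)+
qed

lemma rewr_atom_overlap:
  assumes "rewr_atom r s A A'" and "rewr_atom u v A B"
  shows "(\<exists>C. rewr_atom u v A' C \<and> rewr_atom r s B C) \<or>
     (\<exists>u'. rewr r s u u' \<and> rewr_atom u' v A' B) \<or>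
     (\<exists>r'. rewr u v r r' \<and> rewr_atom r' s B A')"
  using assms(1)
proof cases
  case (Eq a b c d)
  with assms(2) obtain e f where B: "B = Eq e f" "rewrs u v [a, b] [e, f]"
    by (auto elim: rewr_atom_EqE)
  have "length us = length ts" if "rewrs p q ts us" for p q :: "'a tm" and ts us
    using that by (induction ts arbitrary: us) (auto elim: rewrs_ConsE rewrs_NilE)
  then have "\<exists>g h. zs = [g, h]" if "rewrs u v [c, d] zs" for zs
    using that by (fastforce simp: length_Suc_conv)
  with rewr_overlap(2)[OF Eq(3) B(2)] show ?thesis
    unfolding Eq B by (blast intro: rewr_atom.intros)
next
  case (Pred ts us p)
  with assms(2) obtain ws where B: "B = Pred p ws" "rewrs u v ts ws"
    by (auto elim: rewr_atom_PredE)
  from rewr_overlap(2)[OF Pred(3) B(2)] show ?thesis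
    unfolding Pred B by (blast intro: rewr_atom.intros)
qed

section \<open>Replacement and substitution\<close>

lemma rewrs_star_Cons:
  assumes "(rewr r s)\<^sup>*\<^sup>* t u" and "(rewrs r s)\<^sup>*\<^sup>* ts us"
  shows "(rewrs r s)\<^sup>*\<^sup>* (t # ts) (u # us)"
proof -
  have "(rewrs r s)\<^sup>*\<^sup>* (t # ts) (u # ts)"
    using assms(1) by (induction) (auto intro: rewr_rewrs.head rtranclp.rtrancl_into_rtrancl)
  also have "(rewrs r s)\<^sup>*\<^sup>* (u # ts) (u # us)"
    using assms(2) by (induction) (auto intro: rewr_rewrs.tail rtranclp.rtrancl_into_rtrancl)
  finally show ?thesis .
qed

lemma rewrs_star_map:
  "(\<And>t. t \<in> set ts \<Longrightarrow> (rewr r s)\<^sup>*\<^sup>* (f t) (g t)) \<Longrightarrow> (rewrs r s)\<^sup>*\<^sup>* (map f ts) (map g ts)"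
  by (induction ts) (auto intro: rewrs_star_Cons)

text \<open>Substituting for \<open>x\<close> replaces all its occurrences, so one instance of a rule may amount
  to any number of single replacements, possibly none.\<close>

lemma subst_tm_rewr_star: "(rewr r s)\<^sup>*\<^sup>* (subst_tm t x r) (subst_tm t x s)"
proof (induction t)
  case (Fun f ts)
  then have "(rewrs r s)\<^sup>*\<^sup>* (map (\<lambda>t. subst_tm t x r) ts) (map (\<lambda>t. subst_tm t x s) ts)"
    by (rule rewrs_star_map)
  then have "(rewr r s)\<^sup>*\<^sup>* (Fun f (map (\<lambda>t. subst_tm t x r) ts)) (Fun f (map (\<lambda>t. subst_tm t x s) ts))"
    by (induction) (auto intro: rewr_rewrs.arg rtranclp.rtrancl_into_rtrancl)
  then show ?case by simp
qed (auto intro: rewr_rewrs.root)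

lemma subst_rewr_atom_star:
  fixes P :: "('f, 'p) atom"
  shows "(rewr_atom r s)\<^sup>*\<^sup>* (P[x/r]) (P[x/s])"
proof (cases P)
  case (Eq a b)
  have "(rewr_atom r s)\<^sup>*\<^sup>* (Eq (subst_tm a x r) (subst_tm b x r)) (Eq (subst_tm a x s) (subst_tm b x r))"
    using subst_tm_rewr_star[of r s a x]
    by (induction) (auto simp: rewr_atom_Eq_iff intro: rtranclp.rtrancl_into_rtrancl)
  also have "(rewr_atom r s)\<^sup>*\<^sup>* \<dots> (Eq (subst_tm a x s) (subst_tm b x s))"
    using subst_tm_rewr_star[of r s b x]
    by (induction) (auto simp: rewr_atom_Eq_iff intro: rtranclp.rtrancl_into_rtrancl)
  finally show ?thesis using Eq by simp
next
  case (Pred p ts)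
  have "(rewrs r s)\<^sup>*\<^sup>* (map (\<lambda>t. subst_tm t x r) ts) (map (\<lambda>t. subst_tm t x s) ts)"
    by (intro rewrs_star_map subst_tm_rewr_star)
  then have "(rewr_atom r s)\<^sup>*\<^sup>* (Pred p (map (\<lambda>t. subst_tm t x r) ts)) (Pred p (map (\<lambda>t. subst_tm t x s) ts))"
    by (induction) (auto intro: rewr_atom.Pred rtranclp.rtrancl_into_rtrancl)
  then show ?thesis using Pred by simp
qed

text \<open>Freshness is stated through substitution, because only the invariance is needed. Every
  term then has a bound beyond which all variables are fresh, and such bounds can be combined
  along the arguments of a function symbol.\<close>

abbreviation fresh :: "nat \<Rightarrow> 'f tm \<Rightarrow> bool" where
  "fresh x t \<equiv> \<forall>q. subst_tm t x q = t"

lemma eventually_fresh_list: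
  assumes "\<And>t. t \<in> set ts \<Longrightarrow> \<exists>N. \<forall>x\<ge>N. fresh x t"
  shows "\<exists>N. \<forall>x\<ge>N. \<forall>t\<in>set ts. fresh x t"
  using assms
proof (induction ts)
  case (Cons t ts)
  then obtain N where N: "\<forall>x\<ge>N. \<forall>t\<in>set ts. fresh x t" by auto
  from Cons.prems obtain M where "\<forall>x\<ge>M. fresh x t" by auto
  with N have "\<forall>x\<ge>max M N. \<forall>u\<in>set (t # ts). fresh x u" by simp
  then show ?case by blast
qed simp

lemma eventually_fresh: "\<exists>N. \<forall>x\<ge>N. fresh x t"
proof (induction t)
  case (Free y)
  have "\<forall>x\<ge>Suc y. fresh x (Free y)" by auto
  then show ?case by blast
next
  case (Fun f ts)
  then obtain N where "\<forall>x\<ge>N. \<forall>t\<in>set ts. fresh x t"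
    using eventually_fresh_list by blast
  then have "\<forall>x\<ge>N. fresh x (Fun f ts)" by (simp add: map_idI)
  then show ?case by blast
qed auto

text \<open>The context of a replaced occurrence is the term with a fresh variable in its place. The
  variable must be fresh for the whole term, as other occurrences of it would be substituted as
  well; stating the lemma for all large \<open>x\<close> lets one variable serve all arguments of a function
  symbol.\<close>

lemma rewr_context:
  "rewr r s t u \<Longrightarrow> \<exists>N. \<forall>x\<ge>N. \<exists>c. subst_tm c x r = t \<and> subst_tm c x s = u"
  "rewrs r s ts us \<Longrightarrow> \<exists>N. \<forall>x\<ge>N. \<exists>cs.
     map (\<lambda>c. subst_tm c x r) cs = ts \<and> map (\<lambda>c. subst_tm c x s) cs = us"
proof (induction rule: rewr_rewrs.inducts)
  case root
  have "subst_tm (Free x) x r = r \<and> subst_tm (Free x) x s = s" for x by simp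
  then show ?case by blast
next
  case (arg ts us f)
  then obtain N where N: "\<forall>x\<ge>N. \<exists>cs.
     map (\<lambda>c. subst_tm c x r) cs = ts \<and> map (\<lambda>c. subst_tm c x s) cs = us" by blast
  have "\<exists>c. subst_tm c x r = Fun f ts \<and> subst_tm c x s = Fun f us" if x: "x \<ge> N" for x
  proof -
    from N x obtain cs where
      "map (\<lambda>c. subst_tm c x r) cs = ts" "map (\<lambda>c. subst_tm c x s) cs = us" by blast
    then show ?thesis by (intro exI[of _ "Fun f cs"]) simp
  qed
  then show ?case by blast
next
  case (head t u ts)
  then obtain M where M: "\<forall>x\<ge>M. \<exists>c. subst_tm c x r = t \<and> subst_tm c x s = u" by blast
  obtain N where N: "\<forall>x\<ge>N. \<forall>t\<in>set ts. fresh x t"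
    using eventually_fresh_list eventually_fresh by meson
  have "\<exists>cs. map (\<lambda>c. subst_tm c x r) cs = t # ts \<and> map (\<lambda>c. subst_tm c x s) cs = u # ts"
    if x: "x \<ge> max M N" for x
  proof -
    from M x obtain c where "subst_tm c x r = t" "subst_tm c x s = u" by auto
    with N x show ?thesis by (intro exI[of _ "c # ts"]) (simp add: map_idI)
  qed
  then show ?case by blast
next
  case (tail ts us t)
  then obtain M where M: "\<forall>x\<ge>M. \<exists>cs.
     map (\<lambda>c. subst_tm c x r) cs = ts \<and> map (\<lambda>c. subst_tm c x s) cs = us" by blast
  obtain N where N: "\<forall>x\<ge>N. fresh x t"
    using eventually_fresh by meson
  have "\<exists>cs. map (\<lambda>c. subst_tm c x r) cs = t # ts \<and> map (\<lambda>c. subst_tm c x s) cs = t # us"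
    if x: "x \<ge> max M N" for x
  proof -
    from M x obtain cs where
      "map (\<lambda>c. subst_tm c x r) cs = ts" "map (\<lambda>c. subst_tm c x s) cs = us" by auto
    with N x show ?thesis by (intro exI[of _ "t # cs"]) simp
  qed
  then show ?case by blast
qed

lemma rewr_atom_context:
  fixes A B :: "('f, 'p) atom"
  assumes "rewr_atom r s A B"
  obtains P :: "('f, 'p) atom" and x where "P[x/r] = A" and "P[x/s] = B"
  using assms
proof cases
  case (Eq a b c d)
  from rewr_context(2)[OF Eq(3)] obtain x cs where
    cs: "map (\<lambda>c. subst_tm c x r) cs = [a, b]" "map (\<lambda>c. subst_tm c x s) cs = [c, d]"
    by (meson order_refl)
  then obtain e f where "cs = [e, f]" by auto
  with cs Eq show thesis by (intro that[of "Eq e f" x]) simp_all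
next
  case (Pred ts us p)
  from rewr_context(2)[OF Pred(3)] obtain x cs where
    "map (\<lambda>c. subst_tm c x r) cs = ts" "map (\<lambda>c. subst_tm c x s) cs = us" by blast
  with Pred show thesis by (intro that[of "Pred p cs" x]) simp_all
qed

lemma is_Eq_subst [simp]: "is_Eq ((P :: ('f, 'p) atom)[x/r]) \<longleftrightarrow> is_Eq P"
  by (cases P) simp_all

lemma rewr_wf:
  "rewr r s t u \<Longrightarrow> wf_tm L B s \<Longrightarrow> wf_tm L B t \<Longrightarrow> wf_tm L B u"
  "rewrs r s ts us \<Longrightarrow> wf_tm L B s \<Longrightarrow> (\<forall>t\<in>set ts. wf_tm L B t) \<Longrightarrow>
     length us = length ts \<and> (\<forall>u\<in>set us. wf_tm L B u)"
  by (induction rule: rewr_rewrs.inducts) auto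

lemma rewr_atom_wf:
  "rewr_atom r s A A' \<Longrightarrow> wf_tm L B s \<Longrightarrow> wf_atom L B A \<Longrightarrow> wf_atom L B A'"
  by (cases rule: rewr_atom.cases) (auto dest: rewr_wf)

section \<open>Oriented rewriting of sequents\<close>

text \<open>The equality \<open>E\<close> may be used, from the conclusion to the premise, to replace \<open>u\<close> by \<open>v\<close>.
  In the notation of the rule schemata this means \<open>r = v\<close> and \<open>s = u\<close>: the first disjunct is a
  nonlengthening inference with index 2, the second a shortening one with index 1.\<close>

definition oriented :: "('f tm \<Rightarrow> 'f tm \<Rightarrow> bool) \<Rightarrow> ('f, 'p) atom \<Rightarrow> 'f tm \<Rightarrow> 'f tm \<Rightarrow> bool" where
  "oriented prec E u v \<longleftrightarrow> E = Eq u v \<and> \<not> prec u v \<or> E = Eq v u \<and> prec v u"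

lemma oriented_total: "oriented prec (Eq u v) u v \<or> oriented prec (Eq u v) v u"
  by (auto simp: oriented_def)

lemma oriented_unique:
  "oriented prec E r s \<Longrightarrow> oriented prec E u v \<Longrightarrow> r = u \<and> s = v"
  by (auto simp: oriented_def)

text \<open>Rewriting one side of an equality may change its orientation, and nothing can be said
  about when it does.\<close>

lemma oriented_rewr:
  assumes "oriented prec E u v" and "rewr r s u u'"
  obtains E' where "rewr_atom r s E E'" and "oriented prec E' u' v \<or> oriented prec E' v u'"
  using assms oriented_total unfolding oriented_def
  by (metis rewr_atom_Eq_iff)

text \<open>Semishortening derivability with the rules read from the conclusion to the premise, and
  with one occurrence replaced at a time.\<close>

inductive reducible :: "('f tm \<Rightarrow> 'f tm \<Rightarrow> bool) \<Rightarrow> logic \<Rightarrow>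
    ('f, 'p) fm multiset \<Rightarrow> ('f, 'p) fm multiset \<Rightarrow> bool" for prec lg where
  initial: "initial lg (\<Gamma> \<turnstile> \<Delta>) \<Longrightarrow> reducible prec lg \<Gamma> \<Delta>"
| ref: "ref_axiom (\<Gamma> \<turnstile> \<Delta>) \<Longrightarrow> reducible prec lg \<Gamma> \<Delta>"
| right: "Atom E \<in># \<Gamma> \<Longrightarrow> oriented prec E u v \<Longrightarrow> rewr_atom u v P Q \<Longrightarrow>
    reducible prec lg \<Gamma> (add_mset (Atom Q) \<Delta>) \<Longrightarrow> reducible prec lg \<Gamma> (add_mset (Atom P) \<Delta>)"
| left_pred: "Atom E \<in># \<Gamma> \<Longrightarrow> oriented prec E u v \<Longrightarrow> rewr_atom u v P Q \<Longrightarrow> \<not> is_Eq P \<Longrightarrow>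
    reducible prec lg (add_mset (Atom Q) \<Gamma>) \<Delta> \<Longrightarrow> reducible prec lg (add_mset (Atom P) \<Gamma>) \<Delta>"
| left_eq: "Atom E \<in># \<Gamma> \<Longrightarrow> oriented prec E u v \<Longrightarrow> rewr_atom u v F G \<Longrightarrow> is_Eq F \<Longrightarrow>
    reducible prec lg (add_mset (Atom F) (add_mset (Atom G) \<Gamma>)) \<Delta> \<Longrightarrow>
    reducible prec lg (add_mset (Atom F) \<Gamma>) \<Delta>"

lemma initial_weaken: "initial lg (\<Gamma> \<turnstile> \<Delta>) \<Longrightarrow> initial lg (\<Gamma> + \<Theta> \<turnstile> \<Delta>)"
  by (cases rule: initial.cases) (auto intro: initial.intros)

lemma ref_axiom_weaken: "ref_axiom (\<Gamma> \<turnstile> \<Delta>) \<Longrightarrow> ref_axiom (\<Gamma>' \<turnstile> \<Delta>)"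
  by (auto simp: ref_axiom.simps)

lemma reducible_weaken: "reducible prec lg \<Gamma> \<Delta> \<Longrightarrow> reducible prec lg (\<Gamma> + \<Theta>) \<Delta>"
  by (induction rule: reducible.induct)
    (auto intro: reducible.intros initial_weaken ref_axiom_weaken)

text \<open>An initial sequent absorbs a replacement against the orientation: instead of going back
  from \<open>Q\<close> to \<open>P\<close> in the succedent, rewrite \<open>P\<close> to \<open>Q\<close> in the antecedent. The equality cannot
  operate on its own occurrence, whence the hypothesis \<open>E \<noteq> P\<close>.\<close>

lemma reducible_atom:
  assumes "Atom E \<in># \<Gamma>" "Atom P \<in># \<Gamma>" "E \<noteq> P" "oriented prec E u v" "rewr_atom u v P Q"
  shows "reducible prec lg \<Gamma> (add_mset (Atom Q) \<Delta>)"
proof -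
  from \<open>Atom P \<in># \<Gamma>\<close> obtain \<Gamma>' where \<Gamma>: "\<Gamma> = add_mset (Atom P) \<Gamma>'"
    by (blast dest: multi_member_split)
  with assms have E: "Atom E \<in># \<Gamma>'" by auto
  have init: "reducible prec lg (add_mset (Atom Q) \<Gamma>'') (add_mset (Atom Q) \<Delta>)" for \<Gamma>''
    by (intro reducible.initial initial.intros)
  show ?thesis
  proof (cases "is_Eq P")
    case True
    have "reducible prec lg (add_mset (Atom P) (add_mset (Atom Q) \<Gamma>')) (add_mset (Atom Q) \<Delta>)"
      using init[of "add_mset (Atom P) \<Gamma>'"] by (simp add: add_mset_commute)
    with reducible.left_eq[OF E assms(4,5) True] show ?thesis unfolding \<Gamma> by blast
  next
    case False
    from reducible.left_pred[OF E assms(4,5) False init] show ?thesis unfolding \<Gamma> .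
  qed
qed

lemma reducible_add_equation:
  assumes "Atom E \<in># \<Gamma>" "Atom F \<in># \<Gamma>" "E \<noteq> F" "oriented prec E u v" "rewr_atom u v F G" "is_Eq F"
    and "reducible prec lg (add_mset (Atom G) \<Gamma>) \<Delta>"
  shows "reducible prec lg \<Gamma> \<Delta>"
proof -
  from \<open>Atom F \<in># \<Gamma>\<close> obtain \<Gamma>' where \<Gamma>: "\<Gamma> = add_mset (Atom F) \<Gamma>'"
    by (blast dest: multi_member_split)
  with assms have E: "Atom E \<in># \<Gamma>'" by auto
  have "reducible prec lg (add_mset (Atom F) (add_mset (Atom G) \<Gamma>')) \<Delta>"
    using assms(7) unfolding \<Gamma> by (simp add: add_mset_commute)
  from reducible.left_eq[OF E assms(4-6) this] show ?thesis unfolding \<Gamma> .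
qed

lemma reducible_refl_left:
  assumes "Atom E \<in># \<Gamma>" "oriented prec E u v" "rewr u v a b"
  shows "reducible prec lg \<Gamma> (add_mset (Atom (Eq a b)) \<Delta>)"
    and "reducible prec lg \<Gamma> (add_mset (Atom (Eq b a)) \<Delta>)"
proof -
  have "reducible prec lg \<Gamma> (add_mset (Atom (Eq b b)) \<Delta>)"
    by (intro reducible.ref ref_axiom.intros)
  then show "reducible prec lg \<Gamma> (add_mset (Atom (Eq a b)) \<Delta>)"
    "reducible prec lg \<Gamma> (add_mset (Atom (Eq b a)) \<Delta>)"
    using reducible.right[OF assms(1,2)] assms(3) rewr_atom_Eq_iff by blast+
qed

text \<open>If the principal formula of the initial sequent is the operating equality itself, rewriting
  the antecedent may be impossible. But \<open>Q\<close> has \<open>r\<close> replaced in one side of the equality of \<open>r\<close>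
  and \<open>s\<close>. On the side \<open>r\<close> this gives \<open>s = s\<close>; on the side \<open>s\<close> it gives some \<open>s'\<close>, and
  rewriting the remaining \<open>r\<close> to \<open>s\<close> and then \<open>s\<close> to \<open>s'\<close> ends in \<open>s' = s'\<close>.\<close>

lemma reducible_self:
  assumes E: "Atom E \<in># \<Gamma>" and o: "oriented prec E r s" and rw: "rewr_atom r s E Q"
  shows "reducible prec lg \<Gamma> (add_mset (Atom Q) \<Delta>)"
proof -
  have ss: "reducible prec lg \<Gamma> (add_mset (Atom (Eq s s)) \<Delta>)"
    by (intro reducible.ref ref_axiom.intros)
  have st: "reducible prec lg \<Gamma> (add_mset (Atom (Eq r s')) \<Delta>)"
    "reducible prec lg \<Gamma> (add_mset (Atom (Eq s' r)) \<Delta>)" if "rewr r s s s'" for s'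
    using reducible_refl_left[OF E o that] reducible.right[OF E o] rewr_atom_Eq_iff
      rewr_rewrs.root by metis+
  from o have "E = Eq r s \<or> E = Eq s r" by (auto simp: oriented_def)
  then show ?thesis
    using rw ss st by (auto simp: rewr_atom_Eq_iff dest!: rewr_self)
qed

section \<open>Replacement against the orientation\<close>

text \<open>Admissibility of replacement against the orientation. The antecedent is weakened by \<open>\<Theta>\<close>
  because the induction hypothesis has to be used after a new equality has been added to it.\<close>

lemma reducible_against:
  assumes "reducible prec lg \<Gamma> (add_mset (Atom P) \<Delta>)"
    and "Atom E \<in># \<Gamma> + \<Theta>" and "oriented prec E r s" and "rewr_atom r s P P'"
  shows "reducible prec lg (\<Gamma> + \<Theta>) (add_mset (Atom P') \<Delta>)"
  using assms
proof (induction \<Gamma> "add_mset (Atom P) \<Delta>" arbitrary: P P' \<Delta> \<Theta> E r s rule: reducible.induct)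
  case (initial \<Gamma>)
  show ?case
  proof (cases "Atom P \<in># \<Gamma>")
    case True
    then show ?thesis
      using initial.prems reducible_atom reducible_self
      by (metis union_iff)
  next
    case False
    with initial.hyps have "initial lg (\<Gamma> \<turnstile> add_mset (Atom P') \<Delta>)"
      by (auto simp: initial.simps add_eq_conv_ex)
    then show ?thesis by (intro reducible.initial initial_weaken)
  qed
next
  case (ref \<Gamma>)
  from ref.hyps obtain t \<Delta>' where t: "add_mset (Atom P) \<Delta> = add_mset (Atom (Eq t t)) \<Delta>'"
    by (auto simp: ref_axiom.simps)
  then consider "P = Eq t t" | "Atom (Eq t t) \<in># \<Delta>"
    by (auto simp: add_eq_conv_ex)
  then show ?case
  proof cases
    case 1
    with ref.prems(3) reducible_refl_left[OF ref.prems(1,2)] show ?thesis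
      by (auto simp: rewr_atom_Eq_iff)
  next
    case 2
    then obtain \<Delta>'' where "\<Delta> = add_mset (Atom (Eq t t)) \<Delta>''" by (blast dest: multi_member_split)
    then have "ref_axiom (\<Gamma> + \<Theta> \<turnstile> add_mset (Atom P') \<Delta>)"
      by (metis add_mset_commute ref_axiom.intros)
    then show ?thesis by (rule reducible.ref)
  qed
next
  case (right E\<^sub>2 \<Gamma> u v P\<^sub>2 Q \<Delta>\<^sub>2)
  have E2: "Atom E\<^sub>2 \<in># \<Gamma> + \<Theta>" using right.hyps by simp
  from right.hyps(6) consider
    (side) K where "\<Delta> = add_mset (Atom P\<^sub>2) K" "\<Delta>\<^sub>2 = add_mset (Atom P) K"
    | (principal) "P\<^sub>2 = P" "\<Delta>\<^sub>2 = \<Delta>"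
    by (auto simp: add_eq_conv_ex)
  then show ?case
  proof cases
    case side
    have "reducible prec lg (\<Gamma> + \<Theta>) (add_mset (Atom P') (add_mset (Atom Q) K))"
      using right.hyps(5)[OF _ right.prems, of "add_mset (Atom Q) K"] side
      by (simp add: add_mset_commute)
    then show ?thesis
      using reducible.right[OF E2 right.hyps(2,3), of lg "add_mset (Atom P') K"] side
      by (simp add: add_mset_commute)
  next
    case principal
    have IH: "reducible prec lg (\<Gamma> + \<Theta>') (add_mset (Atom Q') \<Delta>)"
      if "Atom E' \<in># \<Gamma> + \<Theta>'" "oriented prec E' p q" "rewr_atom p q Q Q'" for \<Theta>' E' p q Q'
      using right.hyps(5) that principal by blast
    have old: "reducible prec lg (\<Gamma> + \<Theta>') (add_mset (Atom Q) \<Delta>)" for \<Theta>'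
      using right.hyps(4) principal reducible_weaken by blast
    \<comment> \<open>Any equality that relates the sides at which \<open>P'\<close> and \<open>Q\<close> differ will do, whatever its
      orientation: one direction allows an inference, the other the induction hypothesis.\<close>
    have new: "reducible prec lg (add_mset (Atom G) (\<Gamma> + \<Theta>)) (add_mset (Atom P') \<Delta>)"
      if "oriented prec G p q \<or> oriented prec G q p" "rewr_atom p q P' Q" for G p q
      using that(1)
    proof
      assume "oriented prec G p q"
      then show ?thesis
        using that(2) reducible.right[of G "add_mset (Atom G) (\<Gamma> + \<Theta>)" prec p q P' Q lg \<Delta>]
          old[of "add_mset (Atom G) \<Theta>"] by simp
    next
      assume "oriented prec G q p"
      then show ?thesis
        using IH[of G "add_mset (Atom G) \<Theta>" q p P'] rewr_atom_sym[OF that(2)] by simp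
    qed
    have eqs: "is_Eq E" "is_Eq E\<^sub>2"
      using right.hyps(2) right.prems(2) by (auto simp: oriented_def)
    from right.prems(3) right.hyps(3) principal
    have "rewr_atom r s P P'" "rewr_atom u v P Q" by simp_all
    from rewr_atom_overlap[OF this] consider
      (disjoint) C where "rewr_atom u v P' C" "rewr_atom r s Q C"
      | (below) u' where "rewr r s u u'" "rewr_atom u' v P' Q"
      | (above) r' where "rewr u v r r'" "rewr_atom r' s Q P'"
      by blast
    then show ?thesis
    proof cases
      case disjoint
      then show ?thesis
        using IH[OF right.prems(1,2)] reducible.right[OF E2 right.hyps(2)] by blast
    next
      case below
      show ?thesis
      proof (cases "E = E\<^sub>2")
        case True
        \<comment> \<open>A left rule needs two occurrences of equalities, and \<open>\<Gamma>\<close> may contain \<open>E\<close> only once. But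
          here both steps replace \<open>r\<close> by \<open>s\<close> at the same position.\<close>
        then have "u = r" "v = s" using oriented_unique right.hyps(2) right.prems(2) by blast+
        with below have "P' = Q" by (metis rewr_self rewr_atom_trivial)
        then show ?thesis using old by simp
      next
        case False
        obtain G where "rewr_atom r s E\<^sub>2 G" "oriented prec G u' v \<or> oriented prec G v u'"
          using oriented_rewr[OF right.hyps(2) below(1)] .
        then show ?thesis
          using reducible_add_equation[OF right.prems(1) E2 False right.prems(2)] new below(2) eqs
          by blast
      qed
    next
      case above
      show ?thesis
      proof (cases "E = E\<^sub>2")
        case True
        then have "u = r" "v = s" using oriented_unique right.hyps(2) right.prems(2) by blast+
        with above have "P' = Q" by (metis rewr_self rewr_atom_trivial)
        then show ?thesis using old by simp
      next
        case False
        obtain G where "rewr_atom u v E G" "oriented prec G r' s \<or> oriented prec G s r'"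
          using oriented_rewr[OF right.prems(2) above(1)] .
        then show ?thesis
          using reducible_add_equation[OF E2 right.prems(1) False[symmetric] right.hyps(2)]
            new rewr_atom_sym[OF above(2)] eqs by blast
      qed
    qed
  qed
next
  case (left_pred E\<^sub>2 \<Gamma> u v A B)
  \<comment> \<open>The rule replaces \<open>A\<close> by \<open>B\<close>, which is harmless: \<open>A\<close> is not an equality, so \<open>E\<close> survives.\<close>
  then have "E \<noteq> A" by (auto simp: oriented_def)
  with left_pred.prems(1) have "Atom E \<in># add_mset (Atom B) \<Gamma> + \<Theta>" by auto
  from left_pred.hyps(6)[OF refl this left_pred.prems(2,3)] left_pred.hyps show ?case
    by (auto intro: reducible.left_pred)
next
  case (left_eq E\<^sub>2 \<Gamma> u v F G)
  then have "Atom E \<in># add_mset (Atom F) (add_mset (Atom G) \<Gamma>) + \<Theta>" by auto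
  from left_eq.hyps(6)[OF refl this left_eq.prems(2,3)] left_eq.hyps show ?case
    by (auto intro: reducible.left_eq)
qed

text \<open>Each single replacement either follows the orientation of \<open>E\<close>, and is then a right
  inference, or goes against it.\<close>

lemma reducible_replace:
  assumes E: "Atom E \<in># \<Gamma>" "E = Eq r s \<or> E = Eq s r"
    and "(rewr_atom r s)\<^sup>*\<^sup>* P Q" and "reducible prec lg \<Gamma> (add_mset (Atom P) \<Delta>)"
  shows "reducible prec lg \<Gamma> (add_mset (Atom Q) \<Delta>)"
  using assms(3,4)
proof (induction)
  case (step Q R)
  then have Q: "reducible prec lg \<Gamma> (add_mset (Atom Q) \<Delta>)" by simp
  have "oriented prec E r s \<or> oriented prec E s r"
    using E(2) by (auto simp: oriented_def)
  then show ?case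
  proof
    assume "oriented prec E r s"
    with reducible_against[OF Q, of E "{#}"] E(1) step.hyps(2)
    show ?thesis by simp
  next
    assume "oriented prec E s r"
    with reducible.right[OF E(1)] Q rewr_atom_sym[OF step.hyps(2)]
    show ?thesis by blast
  qed
qed simp

section \<open>Translations between derivations and oriented rewriting\<close>

lemma derivation_reducible:
  assumes "is_derivation L lg R12r D" and "endsequent D = (\<Gamma> \<turnstile> \<Delta>)"
  shows "reducible prec lg \<Gamma> \<Delta>"
  using assms
proof (induction D arbitrary: \<Gamma> \<Delta>)
  case (Axiom S)
  then show ?case by (auto intro: reducible.initial reducible.ref)
next
  case (Infer \<rho> r s D S)
  then have "inference \<rho> r s (endsequent D) (\<Gamma> \<turnstile> \<Delta>)" "\<rho> \<in> R12r" by simp_all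
  then show ?case
  proof cases
    case (right i \<Gamma>' P x \<Delta>')
    obtain E :: "('a, 'b) atom" where "operating i r s = Atom E" "E = Eq r s \<or> E = Eq s r"
      by (cases i) auto
    with right Infer reducible_replace[OF _ _ subst_rewr_atom_star, of E \<Gamma> r s prec lg P x \<Delta>']
    show ?thesis by simp
  qed (auto simp: R12r_def)
qed

lemma oriented_inference:
  assumes "Atom E \<in># \<Gamma>" and "oriented prec E u v" and "rewr_atom u v P Q"
  obtains i where "i = Two \<longrightarrow> nonlengthening prec v u" and "i = One \<longrightarrow> shortening prec v u"
    and "\<And>\<Delta>. inference (RepR i) v u (\<Gamma> \<turnstile> add_mset (Atom Q) \<Delta>) (\<Gamma> \<turnstile> add_mset (Atom P) \<Delta>)"
    and "\<And>\<Delta>. \<not> is_Eq P \<Longrightarrow> inference (RepLplus i) v u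
      (add_mset (Atom Q) \<Gamma> \<turnstile> \<Delta>) (add_mset (Atom P) \<Gamma> \<turnstile> \<Delta>)"
    and "\<And>\<Delta>. is_Eq P \<Longrightarrow> inference (RepLplus i) v u
      (add_mset (Atom P) (add_mset (Atom Q) \<Gamma>) \<turnstile> \<Delta>) (add_mset (Atom P) \<Gamma> \<turnstile> \<Delta>)"
proof -
  obtain i where i: "operating i v u = Atom E"
    "i = Two \<longrightarrow> nonlengthening prec v u" "i = One \<longrightarrow> shortening prec v u"
    using assms(2) unfolding oriented_def nonlengthening_def shortening_def
    by (metis index.distinct(1) operating.simps)
  obtain C x where C: "P = C[x/u]" "Q = C[x/v]" using rewr_atom_context[OF assms(3)] by metis
  obtain \<Gamma>' where \<Gamma>: "\<Gamma> = add_mset (operating i v u) \<Gamma>'"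
    using assms(1) i(1) by (metis multi_member_split)
  show thesis
    using that[OF i(2,3)] inference.right[of i v u \<Gamma>' C x]
      inference.left_pred[of C i v u x \<Gamma>'] inference.left_eq[of C i v u x \<Gamma>']
    unfolding C \<Gamma> by (simp add: add_mset_commute)
qed

text \<open>The terms \<open>u\<close> and \<open>v\<close> are the sides of a formula of \<open>L\<close>. So all sequents of a derivation
  built from the conclusion upwards belong to \<open>L\<close> as soon as the endsequent does.\<close>

lemma oriented_formula:
  assumes "oriented prec E u v" and "rewr_atom u v P Q"
    and "is_formula L (Atom E)" and "is_formula L (Atom P)"
  shows "is_formula L (Atom Q)"
  using assms by (auto simp: is_formula_def oriented_def intro: rewr_atom_wf)

lemma reducible_derivation:
  assumes "reducible prec lg \<Gamma> \<Delta>" and "is_sequent L (\<Gamma> \<turnstile> \<Delta>)"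
  shows "\<exists>D. is_derivation L lg R12rlplus D \<and> endsequent D = (\<Gamma> \<turnstile> \<Delta>) \<and> semishortening prec D"
  using assms
proof (induction)
  case (initial \<Gamma> \<Delta>)
  then show ?case by (intro exI[of _ "Axiom (\<Gamma> \<turnstile> \<Delta>)"]) simp
next
  case (ref \<Gamma> \<Delta>)
  then show ?case by (intro exI[of _ "Axiom (\<Gamma> \<turnstile> \<Delta>)"]) (simp add: R12rlplus_def)
next
  case (right E \<Gamma> u v P Q \<Delta>)
  have "is_sequent L (\<Gamma> \<turnstile> add_mset (Atom Q) \<Delta>)"
    using right.prems oriented_formula[OF right.hyps(2,3)] right.hyps(1) by simp
  with right.IH obtain D where D: "is_derivation L lg R12rlplus D"
    "endsequent D = (\<Gamma> \<turnstile> add_mset (Atom Q) \<Delta>)" "semishortening prec D" by blast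
  obtain i where i: "i = Two \<longrightarrow> nonlengthening prec v u" "i = One \<longrightarrow> shortening prec v u"
    "inference (RepR i) v u (\<Gamma> \<turnstile> add_mset (Atom Q) \<Delta>) (\<Gamma> \<turnstile> add_mset (Atom P) \<Delta>)"
    using oriented_inference[OF right.hyps(1-3)] by metis
  with D right.prems show ?case
    by (intro exI[of _ "Infer (RepR i) v u D (\<Gamma> \<turnstile> add_mset (Atom P) \<Delta>)"])
      (cases i; simp add: R12rlplus_def)
next
  case (left_pred E \<Gamma> u v P Q \<Delta>)
  have "is_sequent L (add_mset (Atom Q) \<Gamma> \<turnstile> \<Delta>)"
    using left_pred.prems oriented_formula[OF left_pred.hyps(2,3)] left_pred.hyps(1) by simp
  with left_pred.IH obtain D where D: "is_derivation L lg R12rlplus D"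
    "endsequent D = (add_mset (Atom Q) \<Gamma> \<turnstile> \<Delta>)" "semishortening prec D" by blast
  obtain i where i: "i = Two \<longrightarrow> nonlengthening prec v u" "i = One \<longrightarrow> shortening prec v u"
    "inference (RepLplus i) v u (add_mset (Atom Q) \<Gamma> \<turnstile> \<Delta>) (add_mset (Atom P) \<Gamma> \<turnstile> \<Delta>)"
    using oriented_inference[OF left_pred.hyps(1-3)] left_pred.hyps(4) by metis
  with D left_pred.prems show ?case
    by (intro exI[of _ "Infer (RepLplus i) v u D (add_mset (Atom P) \<Gamma> \<turnstile> \<Delta>)"])
      (cases i; simp add: R12rlplus_def)
next
  case (left_eq E \<Gamma> u v F G \<Delta>)
  have "is_sequent L (add_mset (Atom F) (add_mset (Atom G) \<Gamma>) \<turnstile> \<Delta>)"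
    using left_eq.prems oriented_formula[OF left_eq.hyps(2,3)] left_eq.hyps(1) by simp
  with left_eq.IH obtain D where D: "is_derivation L lg R12rlplus D"
    "endsequent D = (add_mset (Atom F) (add_mset (Atom G) \<Gamma>) \<turnstile> \<Delta>)" "semishortening prec D" by blast
  obtain i where i: "i = Two \<longrightarrow> nonlengthening prec v u" "i = One \<longrightarrow> shortening prec v u"
    "inference (RepLplus i) v u (add_mset (Atom F) (add_mset (Atom G) \<Gamma>) \<turnstile> \<Delta>) (add_mset (Atom F) \<Gamma> \<turnstile> \<Delta>)"
    using oriented_inference[OF left_eq.hyps(1-3)] left_eq.hyps(4) by metis
  with D left_eq.prems show ?case
    by (intro exI[of _ "Infer (RepLplus i) v u D (add_mset (Atom F) \<Gamma> \<turnstile> \<Delta>)"])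
      (cases i; simp add: R12rlplus_def)
qed

theorem proposition22:
  fixes L :: "('f, 'p) language"
    and prec :: "'f tm \<Rightarrow> 'f tm \<Rightarrow> bool"
    and lg :: logic
    and \<Gamma> \<Delta> :: "('f, 'p) fm multiset"
  assumes "antisymp_on {t. is_term L t} prec"
    and "derivable L lg R12r (\<Gamma> \<turnstile> \<Delta>)"
  shows "\<exists>D. is_derivation L lg R12rlplus D \<and> endsequent D = (\<Gamma> \<turnstile> \<Delta>) \<and> semishortening prec D"
proof -
  from assms(2) obtain D where D: "is_derivation L lg R12r D" "endsequent D = (\<Gamma> \<turnstile> \<Delta>)"
    by (auto simp: derivable_def)
  then have "is_sequent L (\<Gamma> \<turnstile> \<Delta>)" by (cases D) auto
  with D show ?thesis by (blast intro: reducible_derivation derivation_reducible)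
qed

end
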